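(* There exist $d>0$ and a non-empty open set $\mathcal{V}\subset C^\infty(S^1\times S^1)$ such that every $f\in\mathcal{V}$ satisfies the following conditions. (i) All functions $f_n:(S^1)^{n+1}\to\mathbb{R}$ $(n\geq 1)$ are Morse functions. (ii) For all $n\geq 1$, $\#\mathrm{Cr}(f_n)=d^{n+1}$.
   Context: $S^1=\mathbb{R}/2\pi\mathbb{Z}$. $C^\infty(S^1\times S^1)$ is the space of real valued $C^\infty$ functions on $S^1\times S^1$ with the $C^\infty$ topology. For $f\in C^\infty(S^1\times S^1)$ and $n\ge 1$, the function $f_n:(S^1)^{n+1}\to\mathbb{R}$ is defined by $f_n(p_1,\dots,p_{n+1}):=\sum_{i=1}^n f(p_i,p_{i+1})$. $\mathrm{Cr}(f_n)$ is the set of critical points of $f_n$, and $\#$ denotes cardinality. A smooth function on a manifold is called a Morse function if all its critical points are non-degenerate. *)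

theory Defs
  imports "HOL-Analysis.Analysis" "Jordan_Normal_Form.Determinant"
begin

quotient_type circle = real / "\<lambda>x y. \<exists>k::int. x - y = 2 * pi * of_int k"
  morphisms rep_circle circle_of
proof (rule equivpI)
  show "reflp (\<lambda>x y. \<exists>k::int. x - y = 2 * pi * of_int k)"
    by (rule reflpI) (rule exI[of _ 0], simp)
  show "symp (\<lambda>x y. \<exists>k::int. x - y = 2 * pi * of_int k)"
  proof (rule sympI)
    fix x y :: real assume "\<exists>k::int. x - y = 2 * pi * of_int k"
    then obtain k :: int where "x - y = 2 * pi * of_int k" ..
    then have "y - x = 2 * pi * of_int (- k)" by simp
    then show "\<exists>k::int. y - x = 2 * pi * of_int k" ..
  qed
  show "transp (\<lambda>x y. \<exists>k::int. x - y = 2 * pi * of_int k)"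
  proof (rule transpI)
    fix x y z :: real
    assume "\<exists>k::int. x - y = 2 * pi * of_int k" "\<exists>k::int. y - z = 2 * pi * of_int k"
    then obtain k l :: int where "x - y = 2 * pi * of_int k" "y - z = 2 * pi * of_int l" by auto
    then have "x - z = 2 * pi * of_int (k + l)" by (simp add: algebra_simps)
    then show "\<exists>k::int. x - z = 2 * pi * of_int k" ..
  qed
qed

instantiation circle :: ab_group_add
begin

lift_definition zero_circle :: circle is "0 :: real" .

lift_definition plus_circle :: "circle \<Rightarrow> circle \<Rightarrow> circle" is "(+) :: real \<Rightarrow> real \<Rightarrow> real"
proof -
  fix a b c d :: real
  assume "\<exists>k::int. a - b = 2 * pi * of_int k" "\<exists>k::int. c - d = 2 * pi * of_int k"
  then obtain k l :: int where "a - b = 2 * pi * of_int k" "c - d = 2 * pi * of_int l" by auto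
  then have "a + c - (b + d) = 2 * pi * of_int (k + l)" by (simp add: algebra_simps)
  then show "\<exists>k::int. a + c - (b + d) = 2 * pi * of_int k" ..
qed

lift_definition uminus_circle :: "circle \<Rightarrow> circle" is "uminus :: real \<Rightarrow> real"
proof -
  fix a b :: real
  assume "\<exists>k::int. a - b = 2 * pi * of_int k"
  then obtain k :: int where "a - b = 2 * pi * of_int k" ..
  then have "- a - (- b) = 2 * pi * of_int (- k)" by simp
  then show "\<exists>k::int. - a - (- b) = 2 * pi * of_int k" ..
qed

definition minus_circle :: "circle \<Rightarrow> circle \<Rightarrow> circle" where
  "minus_circle x y = x + (- y)"

instance
proof
  fix a b c :: circle
  show "a + b + c = a + (b + c)" by transfer (rule exI[of _ 0], simp)
  show "a + b = b + a" by transfer (rule exI[of _ 0], simp)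
  show "0 + a = a" by transfer (rule exI[of _ 0], simp)
  show "- a + a = 0" by transfer (rule exI[of _ 0], simp)
  show "a - b = a + - b" by (rule minus_circle_def)
qed

end

instantiation circle :: topological_space
begin

definition open_circle :: "circle set \<Rightarrow> bool" where
  "open_circle U \<longleftrightarrow> open (circle_of -` U)"

instance
  by standard (auto simp: open_circle_def vimage_Int vimage_Union intro!: open_Int open_UN)

end

text \<open>
  The torus \<open>(S\<^sup>1)\<^sup>m\<close> consists of the points \<open>(p 1, \<dots>, p m)\<close>; as \<open>m\<close> varies,
  all of them live in the one type \<open>nat \<Rightarrow> circle\<close>, whose product topology induces the
  topology of each torus. A function on \<open>(S\<^sup>1)\<^sup>m\<close> is a function on that type, of which
  only the restriction to \<open>torus m\<close> matters.
\<close>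

definition torus :: "nat \<Rightarrow> (nat \<Rightarrow> circle) set" where
  "torus m = {1..m} \<rightarrow>\<^sub>E UNIV"

text \<open>
  Partial derivatives with respect to the angular coordinates. Translation by the
  class of \<open>t\<close>, for \<open>t\<close> near 0, is the standard chart of \<open>\<real>/2\<pi>\<int>\<close> around a point, so no choice of
  representatives is needed.
\<close>

definition partial :: "nat \<Rightarrow> ((nat \<Rightarrow> circle) \<Rightarrow> real) \<Rightarrow> (nat \<Rightarrow> circle) \<Rightarrow> real" where
  "partial i g p = deriv (\<lambda>t. g (p(i := p i + circle_of t))) 0"

definition partials :: "nat list \<Rightarrow> ((nat \<Rightarrow> circle) \<Rightarrow> real) \<Rightarrow> (nat \<Rightarrow> circle) \<Rightarrow> real" where
  "partials js g = foldr partial js g"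

definition smooth :: "nat \<Rightarrow> ((nat \<Rightarrow> circle) \<Rightarrow> real) \<Rightarrow> bool" where
  "smooth m g \<longleftrightarrow> (\<forall>js \<in> lists {1..m}.
     continuous_on (torus m) (partials js g) \<and>
     (\<forall>i\<in>{1..m}. \<forall>p\<in>torus m.
        (\<lambda>t. partials js g (p(i := p i + circle_of t))) field_differentiable (at 0)))"

definition Cr :: "nat \<Rightarrow> ((nat \<Rightarrow> circle) \<Rightarrow> real) \<Rightarrow> (nat \<Rightarrow> circle) set" where
  "Cr m g = {p \<in> torus m. \<forall>i\<in>{1..m}. partial i g p = 0}"

text \<open>Matrices are indexed from 0, coordinates from 1.\<close>

definition hessian :: "nat \<Rightarrow> ((nat \<Rightarrow> circle) \<Rightarrow> real) \<Rightarrow> (nat \<Rightarrow> circle) \<Rightarrow> real Matrix.mat" where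
  "hessian m g p = Matrix.mat m m (\<lambda>(i, j). partials [i + 1, j + 1] g p)"

definition nondegenerate :: "nat \<Rightarrow> ((nat \<Rightarrow> circle) \<Rightarrow> real) \<Rightarrow> (nat \<Rightarrow> circle) \<Rightarrow> bool" where
  "nondegenerate m g p \<longleftrightarrow> Determinant.det (hessian m g p) \<noteq> 0"

definition Morse :: "nat \<Rightarrow> ((nat \<Rightarrow> circle) \<Rightarrow> real) \<Rightarrow> bool" where
  "Morse m g \<longleftrightarrow> smooth m g \<and> (\<forall>p\<in>Cr m g. nondegenerate m g p)"

definition on_torus2 :: "(circle \<times> circle \<Rightarrow> real) \<Rightarrow> (nat \<Rightarrow> circle) \<Rightarrow> real" where
  "on_torus2 f p = f (p 1, p 2)"

definition Cinf :: "(circle \<times> circle \<Rightarrow> real) set" where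
  "Cinf = {f. smooth 2 (on_torus2 f)}"

text \<open>
  The ball of radius \<open>\<epsilon>\<close> for the norm \<open>\<parallel>h\<parallel>\<^sub>k\<close>, the maximum over the torus of all partial
  derivatives of \<open>h\<close> of order at most \<open>k\<close>. The maximum is attained, so it is
  less than \<open>\<epsilon>\<close> iff all the values are.
\<close>

definition Ck_ball :: "nat \<Rightarrow> (circle \<times> circle \<Rightarrow> real) \<Rightarrow> real \<Rightarrow> (circle \<times> circle \<Rightarrow> real) set" where
  "Ck_ball k f \<epsilon> = {g \<in> Cinf. \<forall>js\<in>lists {1..2}. length js \<le> k \<longrightarrow>
     (\<forall>p\<in>torus 2. \<bar>partials js (on_torus2 g) p - partials js (on_torus2 f) p\<bar> < \<epsilon>)}"

definition Cinf_topology :: "(circle \<times> circle \<Rightarrow> real) topology" where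
  "Cinf_topology = topology_generated_by {Ck_ball k f \<epsilon> |k f \<epsilon>. f \<in> Cinf \<and> \<epsilon> > 0}"

lemma topspace_Cinf_topology: "topspace Cinf_topology = Cinf"
proof (intro equalityI subsetI)
  fix f assume "f \<in> topspace Cinf_topology"
  then obtain k h \<epsilon> where "f \<in> Ck_ball k h \<epsilon>"
    unfolding Cinf_topology_def topology_generated_by_topspace by blast
  then show "f \<in> Cinf"
    unfolding Ck_ball_def by (elim CollectE conjE)
next
  fix f assume f: "f \<in> Cinf"
  have "f \<in> Ck_ball 0 f 1"
    unfolding Ck_ball_def using f by simp
  moreover have "Ck_ball 0 f 1 \<in> {Ck_ball k f \<epsilon> |k f \<epsilon>. f \<in> Cinf \<and> \<epsilon> > 0}"
    by (rule CollectI, rule exI[of _ 0], rule exI[of _ f], rule exI[of _ 1]) (simp add: f)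
  ultimately show "f \<in> topspace Cinf_topology"
    unfolding Cinf_topology_def topology_generated_by_topspace by (rule UnionI[rotated])
qed

definition chain_sum :: "(circle \<times> circle \<Rightarrow> real) \<Rightarrow> nat \<Rightarrow> (nat \<Rightarrow> circle) \<Rightarrow> real" where
  "chain_sum f n p = (\<Sum>i=1..n. f (p i, p (i + 1)))"

end

theory Submission
  imports Defs
begin

text \<open>
  The proof perturbs a decoupled chain (an anti-integrable limit). For
  \<open>h(x,y) = cos x + cos y\<close> the function \<open>h\<^sub>n\<close> is a sum of positive multiples of the cosines
  \<open>cos p\<^sub>i\<close>, so its critical points are exactly the \<open>2\<^sup>n\<^sup>+\<^sup>1\<close> points
  with all coordinates in \<open>{0, \<pi>}\<close>, and its Hessian is diagonal. The point is that this picture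
  survives on one \<open>C\<^sup>2\<close>-ball around \<open>h\<close>, independently of \<open>n\<close>: the \<open>i\<close>-th partial
  derivative of a chain sum involves only the one or two summands that contain \<open>p\<^sub>i\<close>, so in the
  maximum norm on the coordinates the size of the perturbation does not grow with the length
  of the chain. Hence \<open>d = 2\<close>.

  Let \<open>f\<close> be within \<open>1/10\<close> of \<open>h\<close> in \<open>C\<^sup>2\<close>. At a critical point of \<open>f\<^sub>n\<close> every
  \<open>\<bar>sin p\<^sub>i\<bar>\<close> is at most \<open>1/10\<close>, so every coordinate lies within distance 1 of \<open>0\<close> or
  of \<open>\<pi>\<close>; the sign of \<open>cos p\<^sub>i\<close> tells which (\<open>near_centre\<close>, \<open>critical_point_near\<close>).
  Conversely, for every set \<open>S\<close> of coordinates that are to be near \<open>\<pi>\<close>, the critical points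
  in the corresponding box are the fixed points of a Newton iteration with frozen derivative,
  which maps the box into itself and contracts the maximum norm by the factor \<open>7/10\<close>
  (\<open>newton_step_box\<close>, \<open>newton_step_contraction\<close>). By Banach's theorem each box contains exactly one
  critical point, which gives a bijection between critical points and subsets of
  \<open>{1, \<dots>, n + 1}\<close> (\<open>bij_betw_Cr\<close>). At a critical point \<open>\<bar>cos p\<^sub>i\<bar>\<close> is large, so
  the Hessian is strictly diagonally dominant and thus invertible (\<open>nondegenerate_Cr\<close>).
\<close>

section \<open>Iterated partial derivatives on tori\<close>

lemma partials_simps [simp]:
  "partials [] g = g"
  "partials (j # js) g = partial j (partials js g)"
  by (simp_all add: partials_def)

lemma circle_of_add: "circle_of (x + y) = circle_of x + circle_of y"
  by (simp add: plus_circle.abs_eq)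

lemma circle_of_0 [simp]: "circle_of 0 = 0"
  by (simp add: zero_circle_def)

lemma circle_cases: obtains x where "u = circle_of x"
  by (induction u rule: circle.abs_induct) blast

text \<open>
  Partial derivatives are formed on the whole type \<open>nat \<Rightarrow> circle\<close>, while smoothness is a
  statement about the points of a torus only. Independence of the coordinates outside \<open>I\<close>
  bridges this gap; it also explains why a summand of a chain sum contributes nothing to a partial
  derivative in the direction of a coordinate that it does not contain.
\<close>

definition depends_on :: "nat set \<Rightarrow> ((nat \<Rightarrow> circle) \<Rightarrow> real) \<Rightarrow> bool" where
  "depends_on I g \<longleftrightarrow> (\<forall>p q. (\<forall>i\<in>I. p i = q i) \<longrightarrow> g p = g q)"

lemma depends_onD: "depends_on I g \<Longrightarrow> (\<And>i. i \<in> I \<Longrightarrow> p i = q i) \<Longrightarrow> g p = g q"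
  unfolding depends_on_def by blast

lemma depends_on_partial:
  assumes "depends_on I g"
  shows "depends_on I (partial j g)"
  unfolding depends_on_def
proof (intro allI impI)
  fix p q :: "nat \<Rightarrow> circle" assume eq: "\<forall>i\<in>I. p i = q i"
  have "g (p(j := p j + circle_of t)) = g (q(j := q j + circle_of t))" for t
    by (rule depends_onD[OF assms]) (use eq in auto)
  then show "partial j g p = partial j g q"
    by (simp add: partial_def)
qed

lemma depends_on_partials: "depends_on I g \<Longrightarrow> depends_on I (partials js g)"
  by (induction js) (auto intro: depends_on_partial)

lemma depends_on_on_torus2: "depends_on {1..2} (on_torus2 f)"
  by (simp add: depends_on_def on_torus2_def)

text \<open>
  Smoothness gives differentiability at points of the torus. An arbitrary point is replaced by its
  restriction to \<open>{1..m}\<close>, which \<open>g\<close> and its derivatives cannot distinguish from it.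
\<close>

lemma smooth_partials_DERIV_0:
  assumes "smooth m g" "depends_on {1..m} g" "js \<in> lists {1..m}" "l \<in> {1..m}"
  shows "((\<lambda>t. partials js g (p(l := p l + circle_of t))) has_real_derivative
           partials (l # js) g p) (at 0)"
proof -
  let ?q = "restrict p {1..m}"
  have dep: "depends_on {1..m} (partials js g)" "depends_on {1..m} (partials (l # js) g)"
    using assms(2) by (rule depends_on_partials)+
  have "(\<lambda>t. partials js g (?q(l := ?q l + circle_of t))) field_differentiable (at 0)"
  proof -
    have "?q \<in> torus m" by (simp add: torus_def)
    with assms show ?thesis unfolding smooth_def by blast
  qed
  then have "((\<lambda>t. partials js g (?q(l := ?q l + circle_of t))) has_real_derivative
           partials (l # js) g ?q) (at 0)"
    by (simp only: partials_simps partial_def field_differentiable_derivI)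
  moreover have "partials js g (?q(l := ?q l + circle_of t))
      = partials js g (p(l := p l + circle_of t))" for t
    by (rule depends_onD[OF dep(1)]) (use assms in auto)
  moreover have "partials (l # js) g ?q = partials (l # js) g p"
    by (rule depends_onD[OF dep(2)]) auto
  ultimately show ?thesis by simp
qed

text \<open>
  The same along a whole coordinate circle, in the form that the mean value inequality consumes.
\<close>

lemma smooth_partials_DERIV:
  assumes "smooth m g" "depends_on {1..m} g" "js \<in> lists {1..m}" "l \<in> {1..m}"
  shows "((\<lambda>t. partials js g (p(l := circle_of t))) has_real_derivative
           partials (l # js) g (p(l := circle_of t))) (at t)"
proof -
  have "((\<lambda>s. partials js g (p(l := circle_of (s + t)))) has_real_derivative
           partials (l # js) g (p(l := circle_of t))) (at 0)"
    using smooth_partials_DERIV_0[OF assms, of "p(l := circle_of t)"]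
    by (simp add: circle_of_add add.commute del: partials_simps)
  then show ?thesis
    using DERIV_shift[of "\<lambda>t. partials js g (p(l := circle_of t))" _ 0 t] by simp
qed

section \<open>Derivatives of a chain sum\<close>

text \<open>
  The derivative along \<open>js\<close> of the summand \<open>f (p (k + 1), p (k + 2))\<close> of a chain sum, with
  \<open>k\<close> counted from 0: that summand is \<open>on_torus2 f\<close> at the shifted point
  \<open>\<lambda>l. p (k + l)\<close>, and it is constant in all directions other than \<open>k + 1\<close> and \<open>k + 2\<close>.
\<close>

definition block_partials ::
  "(circle \<times> circle \<Rightarrow> real) \<Rightarrow> nat list \<Rightarrow> nat \<Rightarrow> (nat \<Rightarrow> circle) \<Rightarrow> real" where
  "block_partials f js k p =
     (if set js \<subseteq> {k + 1, k + 2}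
      then partials (map (\<lambda>j. j - k) js) (on_torus2 f) (\<lambda>l. p (k + l)) else 0)"

lemma block_partials_lists:
  fixes k :: nat
  shows "set js \<subseteq> {k + 1, k + 2} \<Longrightarrow> map (\<lambda>j. j - k) js \<in> lists {1..2}"
  by (induction js) auto

lemma block_partials_DERIV:
  assumes "smooth 2 (on_torus2 f)"
  shows "((\<lambda>t. block_partials f js k (p(j := p j + circle_of t))) has_real_derivative
           block_partials f (j # js) k p) (at 0)"
proof (cases "set js \<subseteq> {k + 1, k + 2}")
  case js: True
  let ?js = "map (\<lambda>j. j - k) js" and ?q = "\<lambda>l. p (k + l)"
  show ?thesis
  proof (cases "j \<in> {k + 1, k + 2}")
    case True
    have upd: "(\<lambda>l. (p(j := v)) (k + l)) = ?q(j - k := v)" for v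
      using True by (auto simp: fun_eq_iff)
    have "?q (j - k) = p j" using True by auto
    moreover have "((\<lambda>t. partials ?js (on_torus2 f) (?q(j - k := ?q (j - k) + circle_of t)))
        has_real_derivative partials ((j - k) # ?js) (on_torus2 f) ?q) (at 0)"
      by (rule smooth_partials_DERIV_0[OF assms depends_on_on_torus2 block_partials_lists[OF js]])
        (use True in auto)
    ultimately show ?thesis
      using js True by (simp add: block_partials_def upd del: fun_upd_apply)
  next
    case False
    have "partials ?js (on_torus2 f) (\<lambda>l. (p(j := v)) (k + l)) = partials ?js (on_torus2 f) ?q" for v
      by (rule depends_onD[OF depends_on_partials[OF depends_on_on_torus2]])
        (use False in \<open>auto simp: numeral_2_eq_2 le_Suc_eq\<close>)
    then show ?thesis
      using js False by (simp add: block_partials_def del: fun_upd_apply)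
  qed
next
  case False
  then show ?thesis by (simp add: block_partials_def)
qed

text \<open>
  Differentiation commutes with the sum because each term stays differentiable at every stage of
  the iteration; this reduces everything about \<open>f\<^sub>n\<close> to the derivatives of \<open>f\<close>.
\<close>

lemma partials_chain_sum:
  assumes "smooth 2 (on_torus2 f)"
  shows "partials js (chain_sum f n) = (\<lambda>p. \<Sum>k<n. block_partials f js k p)"
proof (induction js)
  case Nil
  have "(\<Sum>i=1..n. f (p i, p (i + 1))) = (\<Sum>k<n. f (p (k + 1), p (k + 2)))" for p
    by (rule sum.reindex_bij_witness[of _ Suc "\<lambda>i. i - 1"]) auto
  then show ?case
    by (simp add: chain_sum_def block_partials_def on_torus2_def fun_eq_iff)
next
  case (Cons j js)
  show ?case
  proof
    fix p
    have "((\<lambda>t. \<Sum>k<n. block_partials f js k (p(j := p j + circle_of t))) has_real_derivative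
             (\<Sum>k<n. block_partials f (j # js) k p)) (at 0)"
      by (intro DERIV_sum block_partials_DERIV assms)
    then show "partials (j # js) (chain_sum f n) p = (\<Sum>k<n. block_partials f (j # js) k p)"
      by (simp add: Cons partial_def DERIV_imp_deriv)
  qed
qed

lemma continuous_on_block_partials:
  assumes "smooth 2 (on_torus2 f)"
  shows "continuous_on S (block_partials f js k)"
proof (cases "set js \<subseteq> {k + 1, k + 2}")
  case True
  let ?js = "map (\<lambda>j. j - k) js"
  let ?r = "\<lambda>p. restrict (\<lambda>l. p (k + l)) {1..2::nat} :: nat \<Rightarrow> circle"
  have "continuous_on (torus 2) (partials ?js (on_torus2 f))"
    using assms block_partials_lists[OF True] unfolding smooth_def by blast
  moreover have "continuous_on S ?r"
  proof (rule continuous_on_coordinatewise_then_product)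
    fix l
    show "continuous_on S (\<lambda>p. ?r p l)"
      by (cases "l \<in> {1..2::nat}")
        (auto intro: continuous_on_product_coordinates continuous_on_subset)
  qed
  moreover have "?r ` S \<subseteq> torus 2"
    by (auto simp: torus_def)
  ultimately have "continuous_on S (\<lambda>p. partials ?js (on_torus2 f) (?r p))"
    by (rule continuous_on_compose2)
  moreover have "partials ?js (on_torus2 f) (?r p) = block_partials f js k p" for p
    unfolding block_partials_def if_P[OF True]
    by (rule depends_onD[OF depends_on_partials[OF depends_on_on_torus2]]) auto
  ultimately show ?thesis by simp
next
  case False
  then show ?thesis by (simp add: block_partials_def[abs_def])
qed

lemma smooth_chain_sum:
  assumes "smooth 2 (on_torus2 f)"
  shows "smooth m (chain_sum f n)"
  unfolding smooth_def partials_chain_sum[OF assms]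
proof (intro ballI conjI)
  fix js
  show "continuous_on (torus m) (\<lambda>p. \<Sum>k<n. block_partials f js k p)"
    by (intro continuous_on_sum continuous_on_block_partials assms)
  fix i p
  show "(\<lambda>t. \<Sum>k<n. block_partials f js k (p(i := p i + circle_of t))) field_differentiable at 0"
    unfolding field_differentiable_def
    by (rule exI, rule DERIV_sum, rule block_partials_DERIV[OF assms])
qed

section \<open>The decoupled model\<close>

text \<open>
  The \<open>k\<close>-th derivative of the cosine, as a function on the circle: each differentiation is a
  shift of the argument by \<open>\<pi>/2\<close>.
\<close>

lift_definition cos_deriv :: "nat \<Rightarrow> circle \<Rightarrow> real" is "\<lambda>(k::nat) (x::real). cos (x + real k * pi / 2)"
proof -
  fix k :: nat and x y :: real
  assume "\<exists>j::int. x - y = 2 * pi * of_int j"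
  then obtain j :: int where "x + real k * pi / 2 = (y + real k * pi / 2) + 2 * pi * of_int j"
    by (auto simp: algebra_simps)
  then show "cos (x + real k * pi / 2) = cos (y + real k * pi / 2)"
    by (metis sin_cos_eq_iff)
qed

lemma cos_deriv_circle_of:
  "cos_deriv 0 (circle_of x) = cos x"
  "cos_deriv (Suc 0) (circle_of x) = - sin x"
  "cos_deriv 2 (circle_of x) = - cos x"
  by (simp_all add: cos_deriv.abs_eq cos_add)

lemma cos_deriv_2: "cos_deriv 2 u = - cos_deriv 0 u"
  by (rule circle_cases[of u]) (simp add: cos_deriv_circle_of)

lemma cos_deriv_DERIV:
  "((\<lambda>t. cos_deriv k (u + circle_of t)) has_real_derivative cos_deriv (Suc k) u) (at 0)"
proof -
  obtain x where u: "u = circle_of x" by (rule circle_cases)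
  have "((\<lambda>t. cos (x + t + k * pi / 2)) has_real_derivative - sin (x + 0 + k * pi / 2)) (at 0)"
    by (auto intro!: derivative_eq_intros)
  moreover have "- sin (x + k * pi / 2) = cos (x + Suc k * pi / 2)"
    using cos_add[of "x + k * pi / 2" "pi / 2"] by (simp add: algebra_simps add_divide_distrib)
  ultimately show ?thesis
    by (simp add: u cos_deriv.abs_eq flip: circle_of_add)
qed

lemma continuous_on_cos_deriv: "continuous_on UNIV (cos_deriv k)"
proof (subst continuous_on_open_vimage[OF open_UNIV], intro allI impI)
  fix U :: "real set" assume "open U"
  then have "open ((\<lambda>x. cos (x + real k * pi / 2)) -` U)"
    by (intro open_vimage continuous_intros)
  moreover have "circle_of -` (cos_deriv k -` U) = (\<lambda>x. cos (x + real k * pi / 2)) -` U"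
    by (auto simp: cos_deriv.abs_eq)
  ultimately show "open (cos_deriv k -` U \<inter> UNIV)"
    by (simp add: open_circle_def)
qed

definition cos_cos :: "circle \<times> circle \<Rightarrow> real" where
  "cos_cos = (\<lambda>(u, v). cos_deriv 0 u + cos_deriv 0 v)"

lemma partials_cos_cos_DERIV:
  "((\<lambda>t. if set js \<subseteq> {l} then cos_deriv (length js) ((p(j := p j + circle_of t)) l) else 0)
     has_real_derivative
     (if set (j # js) \<subseteq> {l} then cos_deriv (length (j # js)) (p l) else 0)) (at 0)"
  using cos_deriv_DERIV[of "length js" "p l"] by (cases "j = l"; cases "set js \<subseteq> {l}") auto

text \<open>
  Each of the two summands of the model sees one coordinate only, so every derivative in which
  both directions occur vanishes.
\<close>

lemma partials_cos_cos:
  "partials js (on_torus2 cos_cos) =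
     (\<lambda>p. \<Sum>l\<in>{1,2}. if set js \<subseteq> {l} then cos_deriv (length js) (p l) else 0)"
proof (induction js)
  case Nil
  then show ?case by (simp add: on_torus2_def cos_cos_def fun_eq_iff)
next
  case (Cons j js)
  show ?case
  proof
    fix p
    show "partials (j # js) (on_torus2 cos_cos) p =
       (\<Sum>l\<in>{1,2}. if set (j # js) \<subseteq> {l} then cos_deriv (length (j # js)) (p l) else 0)"
      unfolding partials_simps Cons partial_def
      by (intro DERIV_imp_deriv DERIV_sum partials_cos_cos_DERIV)
  qed
qed

lemma cos_cos_in_Cinf: "cos_cos \<in> Cinf"
  unfolding Cinf_def smooth_def partials_cos_cos mem_Collect_eq
proof (intro ballI conjI)
  fix js :: "nat list"
  have "continuous_on (torus 2) (\<lambda>p. if set js \<subseteq> {l} then cos_deriv (length js) (p l) else 0)" for l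
    by (cases "set js \<subseteq> {l}")
      (auto intro!: continuous_on_compose2[OF continuous_on_cos_deriv]
        continuous_on_subset[OF continuous_on_product_coordinates])
  then show "continuous_on (torus 2)
      (\<lambda>p. \<Sum>l\<in>{1,2}. if set js \<subseteq> {l} then cos_deriv (length js) (p l) else 0)"
    by (intro continuous_on_sum)
  fix i p
  show "(\<lambda>t. \<Sum>l\<in>{1,2}. if set js \<subseteq> {l}
      then cos_deriv (length js) ((p(i := p i + circle_of t)) l) else 0) field_differentiable at 0"
    unfolding field_differentiable_def
    by (rule exI, rule DERIV_sum, rule partials_cos_cos_DERIV)
qed

section \<open>Contractions of cubes and diagonally dominant matrices\<close>

text \<open>
  A uniform limit of bounded continuous functions on any topological space is bounded and
  continuous. This is wanted for the index space \<open>nat\<close>, on which every bounded function is a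
  bounded continuous one, so that the supremum norm serves for all dimensions at once.
\<close>

lemma complete_bcontfun: "complete (UNIV :: ('a::topological_space \<Rightarrow>\<^sub>C 'b::complete_space) set)"
proof (rule completeI)
  fix X :: "nat \<Rightarrow> 'a \<Rightarrow>\<^sub>C 'b" assume X: "Cauchy X"
  have "\<exists>g. uniform_limit UNIV (\<lambda>n. apply_bcontfun (X n)) g sequentially"
    using uniformly_convergent_eq_cauchy[of "\<lambda>_. True" "\<lambda>n. apply_bcontfun (X n)"] X
    unfolding Cauchy_def uniform_limit_sequentially_iff by (metis dist_fun_lt_imp_dist_val_lt)
  then obtain g where "uniform_limit UNIV (\<lambda>n. apply_bcontfun (X n)) g sequentially" ..
  then show "\<exists>l\<in>UNIV. X \<longlonglongrightarrow> l"
    by (rule uniform_limit_bcontfunE) auto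
qed

text \<open>
  Banach's fixed point theorem for the supremum norm on a cube, phrased in coordinates: the ball
  of radius \<open>r\<close> around 0 in the space of bounded sequences is complete, and it is the cube.
\<close>

lemma coordinatewise_contraction_unique_fixpoint:
  fixes T :: "(nat \<Rightarrow> real) \<Rightarrow> nat \<Rightarrow> real"
  assumes c: "0 \<le> c" "c < 1" and r: "0 \<le> r"
    and box: "\<And>x i. (\<And>j. \<bar>x j\<bar> \<le> r) \<Longrightarrow> \<bar>T x i\<bar> \<le> r"
    and contr: "\<And>x y M i. (\<And>j. \<bar>x j\<bar> \<le> r) \<Longrightarrow> (\<And>j. \<bar>y j\<bar> \<le> r) \<Longrightarrow>
      (\<And>j. \<bar>x j - y j\<bar> \<le> M) \<Longrightarrow> \<bar>T x i - T y i\<bar> \<le> c * M"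
  shows "\<exists>!x. (\<forall>j. \<bar>x j\<bar> \<le> r) \<and> T x = x"
proof -
  define F :: "(nat \<Rightarrow>\<^sub>C real) \<Rightarrow> (nat \<Rightarrow>\<^sub>C real)"
    where "F x = Bcontfun (T (apply_bcontfun x))" for x
  have bcont: "g \<in> bcontfun" if "\<forall>j. \<bar>g j\<bar> \<le> r" for g :: "nat \<Rightarrow> real"
    using that by (intro bcontfun_normI[of _ r]) (auto intro: continuous_on_discrete)
  have norm_le: "norm x \<le> r \<longleftrightarrow> (\<forall>j. \<bar>apply_bcontfun x j\<bar> \<le> r)" for x :: "nat \<Rightarrow>\<^sub>C real"
  proof
    assume "norm x \<le> r"
    then have "norm (apply_bcontfun x j) \<le> r" for j
      by (rule order_trans[OF norm_bounded])
    then show "\<forall>j. \<bar>apply_bcontfun x j\<bar> \<le> r" by simp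
  next
    assume "\<forall>j. \<bar>apply_bcontfun x j\<bar> \<le> r"
    then show "norm x \<le> r" by (intro norm_bound) simp
  qed
  then have cball: "x \<in> cball 0 r \<longleftrightarrow> (\<forall>j. \<bar>apply_bcontfun x j\<bar> \<le> r)"
    for x :: "nat \<Rightarrow>\<^sub>C real"
    by simp
  have F: "apply_bcontfun (F x) = T (apply_bcontfun x)" if "x \<in> cball 0 r" for x
    unfolding F_def by (intro Bcontfun_inverse bcont allI box) (use that in \<open>simp only: cball\<close>)
  have fp: "\<exists>!x\<in>cball 0 r. F x = x"
  proof (rule Banach_fix[OF _ _ c])
    show "complete (cball 0 r :: (nat \<Rightarrow>\<^sub>C real) set)"
      by (rule complete_closed_subset[OF closed_cball subset_UNIV complete_bcontfun])
    show "cball 0 r \<noteq> ({} :: (nat \<Rightarrow>\<^sub>C real) set)" using r by simp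
    show "F ` cball 0 r \<subseteq> cball 0 r"
    proof (rule image_subsetI)
      fix x :: "nat \<Rightarrow>\<^sub>C real" assume x: "x \<in> cball 0 r"
      then have "\<bar>T (apply_bcontfun x) j\<bar> \<le> r" for j
        using x unfolding cball by (intro box) simp
      with F[OF x] show "F x \<in> cball 0 r"
        unfolding cball by simp
    qed
  next
    fix x y :: "nat \<Rightarrow>\<^sub>C real" assume xy: "x \<in> cball 0 r" "y \<in> cball 0 r"
    have "\<bar>apply_bcontfun x j - apply_bcontfun y j\<bar> \<le> dist x y" for j
      using dist_bounded[of x j y] by (simp add: dist_real_def)
    then have "\<bar>T (apply_bcontfun x) j - T (apply_bcontfun y) j\<bar> \<le> c * dist x y" for j
      using xy unfolding cball by (intro contr) auto
    then show "dist (F x) (F y) \<le> c * dist x y"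
      by (intro dist_bound) (simp add: F[OF xy(1)] F[OF xy(2)] dist_real_def)
  qed
  have unique: "y = x" if "x \<in> cball 0 r \<and> F x = x" "y \<in> cball 0 r \<and> F y = y" for x y
    using fp that unfolding Ex1_def by metis
  obtain x where x: "x \<in> cball 0 r" "F x = x"
    using ex1_implies_ex[OF fp] by (elim exE conjE)
  show ?thesis
  proof (rule ex1I[of _ "apply_bcontfun x"])
    show "(\<forall>j. \<bar>apply_bcontfun x j\<bar> \<le> r) \<and> T (apply_bcontfun x) = apply_bcontfun x"
      using x F[OF x(1)] by (simp add: norm_le)
  next
    fix y assume y: "(\<forall>j. \<bar>y j\<bar> \<le> r) \<and> T y = y"
    then have inv: "apply_bcontfun (Bcontfun y) = y"
      by (intro Bcontfun_inverse bcont) auto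
    with y have "Bcontfun y \<in> cball 0 r" by (simp add: norm_le)
    moreover from F[OF this] y have "F (Bcontfun y) = Bcontfun y"
      by (intro bcontfun_eqI) (simp add: inv)
    ultimately have "Bcontfun y = x" using x unique by simp
    with inv show "y = apply_bcontfun x" by simp
  qed
qed

text \<open>
  In a kernel vector, consider an entry of maximal absolute value: in its row the diagonal term
  outweighs all others together, so the row cannot yield 0.
\<close>

lemma det_nonzero_if_diagonally_dominant:
  fixes A :: "real Matrix.mat"
  assumes A: "A \<in> carrier_mat m m"
    and dom: "\<And>i. i < m \<Longrightarrow> (\<Sum>j\<in>{..<m} - {i}. \<bar>A $$ (i, j)\<bar>) < \<bar>A $$ (i, i)\<bar>"
  shows "Determinant.det A \<noteq> 0"
proof
  assume "Determinant.det A = 0"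
  then obtain v where v: "v \<in> carrier_vec m" "v \<noteq> 0\<^sub>v m" "A *\<^sub>v v = 0\<^sub>v m"
    using det_0_iff_vec_prod_zero[OF A] by blast
  let ?v = "\<lambda>i. vec_index v i"
  obtain j0 where j0: "j0 < m" "?v j0 \<noteq> 0"
    using v(1,2) by (metis carrier_vecD dim_vec eq_vecI index_zero_vec)
  let ?N = "(\<lambda>i. \<bar>?v i\<bar>) ` {..<m}"
  have "Max ?N \<in> ?N" using j0 by (intro Max_in) auto
  then obtain i where i: "i < m" "\<bar>?v i\<bar> = Max ?N" by force
  have max: "\<bar>?v j\<bar> \<le> \<bar>?v i\<bar>" if "j < m" for j
    using that unfolding i(2) by (intro Max_ge) auto
  have pos: "\<bar>?v i\<bar> > 0" using max[OF j0(1)] j0(2) by linarith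
  have "0 = (\<Sum>j<m. A $$ (i, j) * ?v j)"
  proof -
    have "vec_index (A *\<^sub>v v) i = (\<Sum>j<m. A $$ (i, j) * ?v j)"
      using A v(1) i(1) by (simp add: scalar_prod_def atLeast0LessThan)
    then show ?thesis using v(3) i(1) by simp
  qed
  also have "\<dots> = A $$ (i, i) * ?v i + (\<Sum>j\<in>{..<m} - {i}. A $$ (i, j) * ?v j)"
    using i(1) by (intro sum.remove) auto
  finally have "\<bar>A $$ (i, i)\<bar> * \<bar>?v i\<bar> = \<bar>\<Sum>j\<in>{..<m} - {i}. A $$ (i, j) * ?v j\<bar>"
    by (simp flip: abs_mult)
  also have "\<dots> \<le> (\<Sum>j\<in>{..<m} - {i}. \<bar>A $$ (i, j)\<bar> * \<bar>?v i\<bar>)"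
    by (intro order_trans[OF sum_abs] sum_mono) (auto simp: abs_mult intro: mult_left_mono max)
  also have "\<dots> < \<bar>A $$ (i, i)\<bar> * \<bar>?v i\<bar>"
    using dom[OF i(1)] pos by (simp flip: sum_distrib_right)
  finally show False by simp
qed

section \<open>Functions close to the decoupled model\<close>

lemma cos_ge_half: "1 / 2 \<le> cos x" if "\<bar>x\<bar> \<le> 1" for x :: real
proof -
  have "cos (pi / 3) \<le> cos \<bar>x\<bar>"
    using that pi_gt3 by (intro cos_monotone_0_pi_le) auto
  then show ?thesis by (simp add: cos_60)
qed

lemma circle_of_eq_if_sin_cos_eq:
  "sin x = sin y \<Longrightarrow> cos x = cos y \<Longrightarrow> circle_of x = circle_of y"
  using sin_cos_eq_iff[of x y] by (auto simp: circle.abs_eq_iff)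

lemma arcsin_le_1: "\<bar>arcsin y\<bar> \<le> 1" if "\<bar>y\<bar> \<le> 1 / 10"
proof -
  have "sin (pi / 6) \<le> sin 1"
    using pi_less_4 pi_gt3 by (intro sin_monotone_2pi_le) auto
  then have "y \<le> sin 1" "sin (- 1) \<le> y" using that by (auto simp: sin_30)
  then have "arcsin y \<le> arcsin (sin 1)" "arcsin (sin (- 1)) \<le> arcsin y"
    using that by (auto intro!: arcsin_le_arcsin simp del: sin_minus)
  moreover have "arcsin (sin 1) = 1" "arcsin (sin (- 1)) = - 1"
    using pi_gt3 by (auto intro!: arcsin_sin simp del: sin_minus)
  ultimately show ?thesis by linarith
qed

definition centre :: "nat set \<Rightarrow> nat \<Rightarrow> real" where
  "centre S i = (if i \<in> S then pi else 0)"

text \<open>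
  If the sine is small, the angle is near \<open>0\<close> or near \<open>\<pi>\<close>, according to the sign of the
  cosine. After subtracting that centre the cosine is nonnegative, and the arcsine of the sine
  recovers the remaining angle.
\<close>

lemma near_centre:
  assumes "\<bar>cos_deriv 1 u\<bar> \<le> 1 / 10"
  obtains s where "\<bar>s\<bar> \<le> 1" "u = circle_of ((if cos_deriv 0 u < 0 then pi else 0) + s)"
proof -
  obtain x where u: "u = circle_of x" by (rule circle_cases)
  have sinx: "\<bar>sin x\<bar> \<le> 1 / 10" using assms by (simp add: u cos_deriv_circle_of)
  define a where "a = (if cos x < 0 then pi else 0)"
  define s where "s = arcsin (sin (x - a))"
  have a: "cos (x - a) = \<bar>cos x\<bar>" "\<bar>sin (x - a)\<bar> = \<bar>sin x\<bar>" "sin a = 0"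
    by (auto simp: a_def cos_diff sin_diff)
  have sin_s: "sin s = sin (x - a)" by (simp add: s_def)
  have "cos s = sqrt (1 - (sin (x - a))\<^sup>2)"
    unfolding s_def by (rule cos_arcsin) auto
  also have "\<dots> = cos (x - a)"
    by (simp add: a(1) flip: cos_squared_eq)
  finally have "circle_of s = circle_of (x - a)"
    using sin_s by (rule circle_of_eq_if_sin_cos_eq[rotated])
  then have "circle_of (a + s) = circle_of (a + (x - a))"
    by (simp only: circle_of_add)
  then have us: "u = circle_of (a + s)" by (simp add: u)
  have a_eq: "a = (if cos_deriv 0 u < 0 then pi else 0)"
    by (simp add: a_def u cos_deriv_circle_of)
  have "\<bar>s\<bar> \<le> 1"
    unfolding s_def by (rule arcsin_le_1) (use a(2) sinx in simp)
  moreover from us have "u = circle_of ((if cos_deriv 0 u < 0 then pi else 0) + s)"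
    unfolding a_eq .
  ultimately show thesis by (rule that)
qed

text \<open>
  The (zero-based) indices of the summands in which \<open>p i\<close> occurs: two of them in the interior
  of the chain, one at either end. Estimating summand by summand makes the ends no special case.
\<close>

definition blocks :: "nat \<Rightarrow> nat \<Rightarrow> nat set" where
  "blocks n i = {k. k < n \<and> i \<in> {k + 1, k + 2}}"

lemma finite_blocks [simp]: "finite (blocks n i)"
  by (simp add: blocks_def)

lemma card_blocks_pos:
  assumes "n \<ge> 1" "i \<in> {1..n + 1}"
  shows "card (blocks n i) > 0"
proof -
  have "(if i = 1 then 0 else i - 2) \<in> blocks n i" using assms by (auto simp: blocks_def)
  then show ?thesis by (auto simp: card_gt_0_iff)
qed

context
  fixes f :: "circle \<times> circle \<Rightarrow> real"
  assumes f: "f \<in> Ck_ball 2 cos_cos (1 / 10)"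
begin

lemma smooth_f: "smooth 2 (on_torus2 f)"
  using f by (simp add: Ck_ball_def Cinf_def)

lemmas partials_f_depend = depends_on_partials[OF depends_on_on_torus2[of f]]

lemma close_to_model:
  assumes "js \<in> lists {1..2}" "length js \<le> 2"
  shows "\<bar>partials js (on_torus2 f) q - partials js (on_torus2 cos_cos) q\<bar> < 1 / 10"
proof -
  let ?q = "restrict q {1..2}"
  have "?q \<in> torus 2" by (simp add: torus_def)
  then have "\<bar>partials js (on_torus2 f) ?q - partials js (on_torus2 cos_cos) ?q\<bar> < 1 / 10"
    using f assms unfolding Ck_ball_def by blast
  moreover have "partials js (on_torus2 h) ?q = partials js (on_torus2 h) q" for h
    by (rule depends_onD[OF depends_on_partials[OF depends_on_on_torus2]]) auto
  ultimately show ?thesis by simp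
qed

lemma first_partial_near:
  assumes "l \<in> {1, 2}"
  shows "\<bar>partials [l] (on_torus2 f) q - cos_deriv 1 (q l)\<bar> < 1 / 10"
  using close_to_model[of "[l]" q] assms by (auto simp: partials_cos_cos simp del: partials_simps)

lemma diagonal_partial_near:
  assumes "l \<in> {1, 2}"
  shows "\<bar>partials [l, l] (on_torus2 f) q + cos_deriv 0 (q l)\<bar> < 1 / 10"
proof -
  have "\<bar>partials [l, l] (on_torus2 f) q - cos_deriv 2 (q l)\<bar> < 1 / 10"
    using close_to_model[of "[l, l]" q] assms
    by (auto simp: partials_cos_cos numeral_2_eq_2 simp del: partials_simps)
  then show ?thesis by (simp add: cos_deriv_2)
qed

lemma mixed_partial_near:
  assumes "l \<in> {1, 2}" "l' \<in> {1, 2}" "l \<noteq> l'"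
  shows "\<bar>partials [l', l] (on_torus2 f) q\<bar> < 1 / 10"
  using close_to_model[of "[l', l]" q] assms
  by (auto simp: partials_cos_cos simp del: partials_simps)

text \<open>
  The estimate behind the Newton iteration, for one summand. In the model,
  \<open>t + cos a * E\<close> equals \<open>t - cos a * sin t\<close>, whose derivative \<open>1 - cos (t - a)\<close> lies
  between 0 and \<open>1/2\<close> near the centre \<open>a\<close>. The perturbation adds \<open>1/10\<close> to this bound, and
  another \<open>1/10\<close> for the dependence on the neighbouring coordinate.
\<close>

lemma block_contraction:
  fixes X Y :: "nat \<Rightarrow> real" and l :: nat and a :: real
  defines "E \<equiv> \<lambda>Z. partials [l] (on_torus2 f) (\<lambda>j. circle_of (Z j))"
  assumes l: "l \<in> {1, 2}" and a: "a \<in> {0, pi}"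
    and near: "\<bar>X l - a\<bar> \<le> 1" "\<bar>Y l - a\<bar> \<le> 1"
    and M: "\<And>j. j \<in> {1, 2} \<Longrightarrow> \<bar>X j - Y j\<bar> \<le> M"
  shows "\<bar>X l - Y l + cos a * (E X - E Y)\<bar> \<le> 7 / 10 * M"
proof -
  define l' where "l' = 3 - l"
  have l': "l' \<in> {1, 2}" "l' \<noteq> l" "{1, 2} = {l, l'}" using l by (auto simp: l'_def)
  \<comment> \<open>Go from \<open>X\<close> to \<open>Y\<close> through \<open>Z\<close>, changing one coordinate at a time.\<close>
  define Z where "Z = Y(l := X l)"
  have lists: "[l] \<in> lists {1..2}" "l \<in> {1..2}" "l' \<in> {1..2}" using l l' by auto
  have upd: "(\<lambda>j. circle_of ((W(i := t)) j)) = (\<lambda>j. circle_of (W j))(i := circle_of t)" for W i t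
    by (auto simp: fun_eq_iff)
  have D: "((\<lambda>t. E (W(i := t))) has_real_derivative
      partials [i, l] (on_torus2 f) (\<lambda>j. circle_of ((W(i := t)) j))) (at t within T)"
    if "i \<in> {1..2}" for W i t T
    unfolding E_def upd
    by (rule has_field_derivative_at_within)
      (rule smooth_partials_DERIV[OF smooth_f depends_on_on_torus2 lists(1) that])
  have "E X = E (Z(l' := X l'))"
    unfolding E_def by (rule depends_onD[OF partials_f_depend]) (use l' in \<open>auto simp: Z_def numeral_2_eq_2 le_Suc_eq\<close>)
  moreover have "E Z = E (Z(l' := Y l'))"
    unfolding E_def by (rule depends_onD[OF partials_f_depend]) (use l' in \<open>auto simp: Z_def\<close>)
  moreover have "norm (E (Z(l' := X l')) - E (Z(l' := Y l'))) \<le> 1 / 10 * norm (X l' - Y l')"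
    by (rule field_differentiable_bound[OF convex_UNIV D[OF lists(3)]])
      (use less_imp_le[OF mixed_partial_near[OF l l'(1) l'(2)[symmetric]]] in \<open>auto simp del: partials_simps\<close>)
  ultimately have 1: "\<bar>E X - E Z\<bar> \<le> 1 / 10 * M"
    using M[OF l'(1)] by simp
  define h where "h t = t + cos a * E (Y(l := t))" for t
  let ?S = "{a - 1..a + 1}"
  let ?h' = "\<lambda>t. 1 + cos a * partials [l, l] (on_torus2 f) (\<lambda>j. circle_of ((Y(l := t)) j))"
  have "norm (h (X l) - h (Y l)) \<le> 6 / 10 * norm (X l - Y l)"
  proof (rule field_differentiable_bound[of ?S h ?h'])
    fix t assume t: "t \<in> ?S"
    show "(h has_real_derivative ?h' t) (at t within ?S)"
      unfolding h_def by (intro DERIV_add DERIV_ident DERIV_cmult D lists)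
    have "1 / 2 \<le> cos (t - a)" using t by (intro cos_ge_half) auto
    moreover have "cos (t - a) = cos a * cos t" using a by (auto simp: cos_diff)
    moreover define P where "P = partials [l, l] (on_torus2 f) (\<lambda>j. circle_of ((Y(l := t)) j))"
    moreover have "\<bar>P + cos t\<bar> < 1 / 10"
      unfolding P_def using diagonal_partial_near[OF l, of "\<lambda>j. circle_of ((Y(l := t)) j)"]
      by (simp add: cos_deriv_circle_of del: partials_simps)
    moreover have "cos t \<le> 1" "- 1 \<le> cos t" by auto
    moreover have "(cos a * P = P \<and> cos a * cos t = cos t) \<or> (cos a * P = - P \<and> cos a * cos t = - cos t)"
      using a by auto
    ultimately have "\<bar>1 + cos a * P\<bar> \<le> 6 / 10" by linarith
    then show "norm (?h' t) \<le> 6 / 10" by (simp only: P_def real_norm_def)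
  qed (use near in auto)
  moreover have "h (X l) - h (Y l) = X l - Y l + cos a * (E Z - E Y)"
    by (simp add: h_def Z_def algebra_simps)
  ultimately have 2: "\<bar>X l - Y l + cos a * (E Z - E Y)\<bar> \<le> 6 / 10 * M"
    using M[OF l] by simp
  have "\<bar>cos a * (E X - E Z)\<bar> = \<bar>E X - E Z\<bar>" using a by auto
  moreover have "X l - Y l + cos a * (E X - E Y)
      = (X l - Y l + cos a * (E Z - E Y)) + cos a * (E X - E Z)"
    by (simp add: algebra_simps)
  ultimately show ?thesis using 1 2 by linarith
qed

lemma partial_chain_sum:
  "partial i (chain_sum f n) p =
     (\<Sum>k\<in>blocks n i. partials [i - k] (on_torus2 f) (\<lambda>l. p (k + l)))"
proof -
  have "partial i (chain_sum f n) p = (\<Sum>k<n. block_partials f [i] k p)"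
    using partials_chain_sum[OF smooth_f, of "[i]" n] by (simp add: fun_eq_iff)
  also have "\<dots> = (\<Sum>k\<in>blocks n i. block_partials f [i] k p)"
    by (rule sum.mono_neutral_right) (auto simp: blocks_def block_partials_def)
  also have "\<dots> = (\<Sum>k\<in>blocks n i. partials [i - k] (on_torus2 f) (\<lambda>l. p (k + l)))"
    by (rule sum.cong) (auto simp: blocks_def block_partials_def)
  finally show ?thesis .
qed

lemma partial_chain_sum_near:
  "\<bar>partial i (chain_sum f n) p - card (blocks n i) * cos_deriv 1 (p i)\<bar> \<le> card (blocks n i) / 10"
proof -
  have "\<bar>partials [i - k] (on_torus2 f) (\<lambda>l. p (k + l)) - cos_deriv 1 (p i)\<bar> \<le> 1 / 10"
    if "k \<in> blocks n i" for k
  proof -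
    have "i - k \<in> {1, 2}" "k + (i - k) = i" using that by (auto simp: blocks_def)
    with first_partial_near[of "i - k" "\<lambda>l. p (k + l)"] show ?thesis by simp
  qed
  then have "\<bar>\<Sum>k\<in>blocks n i. partials [i - k] (on_torus2 f) (\<lambda>l. p (k + l)) - cos_deriv 1 (p i)\<bar>
      \<le> (\<Sum>k\<in>blocks n i. 1 / 10)"
    by (intro order_trans[OF sum_abs] sum_mono)
  then show ?thesis
    by (simp add: partial_chain_sum sum_subtractf)
qed

text \<open>
  Newton's method for the vanishing of the gradient, in the coordinates \<open>x\<close> relative to the
  centres, with the Hessian replaced by its value for the model at the centres: the diagonal matrix
  with entries \<open>- card (blocks n i) * cos (centre S i)\<close>. Since \<open>cos (centre S i)\<close> is a
  sign, it is its own inverse. Coordinates that do not belong to the torus are set to 0, so that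
  they do not spoil uniqueness of the fixed point.
\<close>

definition newton_step :: "nat set \<Rightarrow> nat \<Rightarrow> (nat \<Rightarrow> real) \<Rightarrow> nat \<Rightarrow> real" where
  "newton_step S n x i =
     (if i \<in> {1..n + 1}
      then x i + cos (centre S i) / card (blocks n i)
             * partial i (chain_sum f n) (\<lambda>j. circle_of (centre S j + x j))
      else 0)"

text \<open>
  A coordinate of the Newton step is an average, over the blocks containing it, of the maps treated
  in \<open>block_contraction\<close>; averaging preserves the contraction factor, whatever the number of
  blocks.
\<close>

lemma newton_step_contraction:
  assumes n: "n \<ge> 1" and x: "\<And>j. \<bar>x j\<bar> \<le> 1" and y: "\<And>j. \<bar>y j\<bar> \<le> 1"
    and M: "\<And>j. \<bar>x j - y j\<bar> \<le> M"
  shows "\<bar>newton_step S n x i - newton_step S n y i\<bar> \<le> 7 / 10 * M"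
proof (cases "i \<in> {1..n + 1}")
  case True
  define c where "c = real (card (blocks n i))"
  have c: "c > 0" using card_blocks_pos[OF n True] by (simp add: c_def)
  let ?a = "centre S i"
  let ?E = "\<lambda>z k. partials [i - k] (on_torus2 f) (\<lambda>l. circle_of (centre S (k + l) + z (k + l)))"
  have block: "\<bar>x i - y i + cos ?a * (?E x k - ?E y k)\<bar> \<le> 7 / 10 * M" if "k \<in> blocks n i" for k
  proof -
    have k: "i - k \<in> {1, 2}" "k + (i - k) = i" using that by (auto simp: blocks_def)
    show ?thesis
      using block_contraction[OF k(1), where a = ?a and M = M
          and X = "\<lambda>l. centre S (k + l) + x (k + l)" and Y = "\<lambda>l. centre S (k + l) + y (k + l)"]
      by (simp add: k(2) x y M centre_def[of S i] del: partials_simps)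
  qed
  have "c * (newton_step S n x i - newton_step S n y i)
      = (\<Sum>k\<in>blocks n i. x i - y i + cos ?a * (?E x k - ?E y k))"
    using True c
    by (simp add: newton_step_def partial_chain_sum sum.distrib sum_subtractf sum_distrib_left
        right_diff_distrib distrib_left del: partials_simps flip: c_def)
  also have "\<bar>\<dots>\<bar> \<le> (\<Sum>k\<in>blocks n i. 7 / 10 * M)"
    by (intro order_trans[OF sum_abs] sum_mono block)
  finally have "c * \<bar>newton_step S n x i - newton_step S n y i\<bar> \<le> c * (7 / 10 * M)"
    using c by (simp add: abs_mult c_def)
  then show ?thesis using c by (simp only: mult_le_cancel_left_pos)
next
  case False
  then show ?thesis using M[of 0] by (auto simp: newton_step_def)
qed

text \<open>
  At the centres the model has no gradient, so the step moves the centre by at most \<open>1/10\<close>;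
  together with the contraction this leaves room, as \<open>7/10 + 1/10 \<le> 1\<close>.
\<close>

lemma newton_step_box:
  assumes n: "n \<ge> 1" and x: "\<And>j. \<bar>x j\<bar> \<le> 1"
  shows "\<bar>newton_step S n x i\<bar> \<le> 1"
proof -
  have "\<bar>newton_step S n x i - newton_step S n (\<lambda>_. 0) i\<bar> \<le> 7 / 10 * 1"
    by (rule newton_step_contraction[OF n]) (use x in auto)
  moreover have "\<bar>newton_step S n (\<lambda>_. 0) i\<bar> \<le> 1 / 10"
  proof (cases "i \<in> {1..n + 1}")
    case True
    define c where "c = real (card (blocks n i))"
    define g where "g = partial i (chain_sum f n) (\<lambda>j. circle_of (centre S j))"
    have c: "c > 0" using card_blocks_pos[OF n True] by (simp add: c_def)
    have "\<bar>g\<bar> \<le> c / 10"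
      using partial_chain_sum_near[of i n "\<lambda>j. circle_of (centre S j)"]
      by (cases "i \<in> S") (simp_all add: g_def c_def cos_deriv_circle_of centre_def[of S i] del: circle_of_0)
    then have "\<bar>g\<bar> / c \<le> 1 / 10" using c by (simp add: field_simps)
    moreover have "\<bar>newton_step S n (\<lambda>_. 0) i\<bar> = \<bar>g\<bar> / c"
      using True c by (simp add: newton_step_def g_def centre_def[of S i] flip: c_def)
    ultimately show ?thesis by simp
  next
    case False
    show ?thesis unfolding newton_step_def if_not_P[OF False] by simp
  qed
  ultimately show ?thesis by linarith
qed

lemma newton_step_unique_fixpoint:
  assumes "n \<ge> 1"
  shows "\<exists>!x. (\<forall>j. \<bar>x j\<bar> \<le> 1) \<and> newton_step S n x = x"
proof (rule coordinatewise_contraction_unique_fixpoint)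
  show "\<bar>newton_step S n x i\<bar> \<le> 1" if "\<And>j. \<bar>x j\<bar> \<le> 1" for x i
    using assms that by (rule newton_step_box)
  show "\<bar>newton_step S n x i - newton_step S n y i\<bar> \<le> 7 / 10 * M"
    if "\<And>j. \<bar>x j\<bar> \<le> 1" "\<And>j. \<bar>y j\<bar> \<le> 1" "\<And>j. \<bar>x j - y j\<bar> \<le> M" for x y M i
    using assms that by (rule newton_step_contraction)
qed simp_all

lemma newton_step_fixpoint_iff:
  assumes "n \<ge> 1"
  shows "newton_step S n x = x \<longleftrightarrow> (\<forall>i. i \<notin> {1..n + 1} \<longrightarrow> x i = 0) \<and>
     (\<forall>i\<in>{1..n + 1}. partial i (chain_sum f n) (\<lambda>j. circle_of (centre S j + x j)) = 0)"
proof -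
  have "newton_step S n x i = x i \<longleftrightarrow>
      (if i \<in> {1..n + 1} then partial i (chain_sum f n) (\<lambda>j. circle_of (centre S j + x j)) = 0
       else x i = 0)" for i
    using card_blocks_pos[OF assms, of i] by (auto simp: newton_step_def centre_def[of S i])
  then show ?thesis unfolding fun_eq_iff by (auto split: if_splits)
qed

lemma critical_point_near:
  assumes "n \<ge> 1" "p \<in> Cr (n + 1) (chain_sum f n)" "i \<in> {1..n + 1}"
  shows "\<bar>cos_deriv 1 (p i)\<bar> \<le> 1 / 10"
proof -
  have "partial i (chain_sum f n) p = 0" using assms by (simp add: Cr_def)
  then have "card (blocks n i) * \<bar>cos_deriv 1 (p i)\<bar> \<le> card (blocks n i) * (1 / 10)"
    using partial_chain_sum_near[of i n p] by (simp add: abs_mult)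
  then show ?thesis
    using card_blocks_pos[OF assms(1,3)] by (simp only: mult_le_cancel_left_pos of_nat_0_less_iff)
qed

text \<open>
  A critical point is determined by the set of coordinates at which the cosine is negative, and
  every set occurs: the critical points with sign pattern \<open>S\<close> are the fixed points of the Newton
  step of \<open>S\<close> in the unit box, and there is exactly one of those.
\<close>

lemma bij_betw_Cr:
  assumes n: "n \<ge> 1"
  shows "bij_betw (\<lambda>p. {i \<in> {1..n + 1}. cos_deriv 0 (p i) < 0})
           (Cr (n + 1) (chain_sum f n)) (Pow {1..n + 1})"
proof -
  define I where "I = {1..n + 1}"
  define sig where "sig p = {i \<in> I. cos_deriv 0 (p i) < 0}" for p :: "nat \<Rightarrow> circle"
  let ?C = "Cr (n + 1) (chain_sum f n)"
  have dep: "depends_on I (partial i (chain_sum f n))" for i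
    by (rule depends_on_partial) (auto simp: depends_on_def chain_sum_def I_def intro!: sum.cong)
  have C: "p \<in> ?C \<longleftrightarrow> p \<in> I \<rightarrow>\<^sub>E UNIV \<and> (\<forall>i\<in>I. partial i (chain_sum f n) p = 0)" for p
    by (simp add: Cr_def torus_def I_def)
  note fixpoint = newton_step_fixpoint_iff[OF n, folded I_def]
  \<comment> \<open>Every critical point arises from a fixed point of the Newton step for its own sign pattern.\<close>
  have lift: "\<exists>x. (\<forall>j. \<bar>x j\<bar> \<le> 1) \<and> newton_step (sig p) n x = x \<and>
      (\<forall>i\<in>I. p i = circle_of (centre (sig p) i + x i))" if p: "p \<in> ?C" for p
  proof -
    have "\<exists>s. \<bar>s\<bar> \<le> 1 \<and> p i = circle_of (centre (sig p) i + s)" if "i \<in> I" for i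
    proof -
      obtain s where "\<bar>s\<bar> \<le> 1" "p i = circle_of ((if cos_deriv 0 (p i) < 0 then pi else 0) + s)"
        using near_centre[OF critical_point_near[OF n p]] \<open>i \<in> I\<close> unfolding I_def by metis
      with \<open>i \<in> I\<close> show ?thesis by (intro exI[of _ s]) (simp add: centre_def sig_def)
    qed
    then obtain s where s: "\<And>i. i \<in> I \<Longrightarrow> \<bar>s i\<bar> \<le> 1 \<and> p i = circle_of (centre (sig p) i + s i)"
      by metis
    define x where "x i = (if i \<in> I then s i else 0)" for i
    have "partial i (chain_sum f n) (\<lambda>j. circle_of (centre (sig p) j + x j))
        = partial i (chain_sum f n) p" for i
      by (rule depends_onD[OF dep]) (simp add: x_def s)
    with p have "newton_step (sig p) n x = x"
      unfolding fixpoint C by (simp add: x_def)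
    then show ?thesis by (intro exI[of _ x]) (auto simp: x_def s)
  qed
  have "inj_on sig ?C"
  proof (rule inj_onI)
    fix p q assume pq: "p \<in> ?C" "q \<in> ?C" "sig p = sig q"
    obtain x y where x: "\<forall>j. \<bar>x j\<bar> \<le> 1" "newton_step (sig p) n x = x"
        "\<forall>i\<in>I. p i = circle_of (centre (sig p) i + x i)"
      and y: "\<forall>j. \<bar>y j\<bar> \<le> 1" "newton_step (sig p) n y = y"
        "\<forall>i\<in>I. q i = circle_of (centre (sig p) i + y i)"
      using lift[OF pq(1)] lift[OF pq(2)] pq(3) by metis
    then have "x = y"
      using newton_step_unique_fixpoint[OF n, of "sig p"] by blast
    then show "p = q"
      using pq(1,2) x y unfolding C by (intro PiE_ext[of p I "\<lambda>_. UNIV" q]) auto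
  qed
  moreover have "sig ` ?C = Pow I"
  proof
    show "sig ` ?C \<subseteq> Pow I" by (auto simp: sig_def)
    show "Pow I \<subseteq> sig ` ?C"
    proof
      fix S assume S: "S \<in> Pow I"
      obtain x where x: "\<forall>j. \<bar>x j\<bar> \<le> 1" "newton_step S n x = x"
        using newton_step_unique_fixpoint[OF n, of S] by blast
      define p where "p = restrict (\<lambda>j. circle_of (centre S j + x j)) I"
      have "partial i (chain_sum f n) p
          = partial i (chain_sum f n) (\<lambda>j. circle_of (centre S j + x j))" for i
        by (rule depends_onD[OF dep]) (simp add: p_def)
      then have "p \<in> ?C"
        using x(2) unfolding fixpoint C by (simp add: p_def)
      moreover have "cos_deriv 0 (p i) < 0 \<longleftrightarrow> i \<in> S" if "i \<in> I" for i
      proof -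
        have "cos (x i) > 0" using cos_ge_half[of "x i"] x(1) by auto
        then show ?thesis
          using that by (auto simp: p_def cos_deriv_circle_of centre_def)
      qed
      then have "sig p = S" using S by (auto simp: sig_def)
      ultimately show "S \<in> sig ` ?C" by blast
    qed
  qed
  ultimately have "bij_betw sig ?C (Pow I)" by (simp add: bij_betw_def)
  then show ?thesis unfolding sig_def[abs_def] I_def .
qed

lemma hessian_entry:
  assumes "i < m" "j < m"
  shows "hessian m (chain_sum f n) p $$ (i, j)
    = (\<Sum>k\<in>blocks n (i + 1). block_partials f [i + 1, j + 1] k p)"
proof -
  have "hessian m (chain_sum f n) p $$ (i, j) = (\<Sum>k<n. block_partials f [i + 1, j + 1] k p)"
    using assms by (simp add: hessian_def partials_chain_sum[OF smooth_f] del: partials_simps)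
  also have "\<dots> = (\<Sum>k\<in>blocks n (i + 1). block_partials f [i + 1, j + 1] k p)"
    by (rule sum.mono_neutral_right) (auto simp: blocks_def block_partials_def)
  finally show ?thesis .
qed

text \<open>
  Each block that contains a coordinate couples it to a single other one.
\<close>

lemma hessian_off_diagonal:
  assumes "i < m"
  shows "(\<Sum>j\<in>{..<m} - {i}. \<bar>hessian m (chain_sum f n) p $$ (i, j)\<bar>)
    \<le> card (blocks n (i + 1)) / 10"
proof -
  have block: "(\<Sum>j\<in>{..<m} - {i}. \<bar>block_partials f [i + 1, j + 1] k p\<bar>) \<le> 1 / 10"
    if k: "k \<in> blocks n (i + 1)" for k
  proof -
    \<comment> \<open>The other coordinate of block \<open>k\<close>, in the zero-based numbering of matrix columns.\<close>
    define j' where "j' = (if i = k then k + 1 else k)"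
    have "\<bar>block_partials f [i + 1, j + 1] k p\<bar> \<le> (if j = j' then 1 / 10 else 0)" if "j \<noteq> i" for j
    proof (cases "j \<in> {k, k + 1}")
      case True
      have "i + 1 - k \<in> {1, 2}" "j + 1 - k \<in> {1, 2}" "j + 1 - k \<noteq> i + 1 - k" "j = j'"
        using k True that by (auto simp: blocks_def j'_def)
      moreover have "set [i + 1, j + 1] \<subseteq> {k + 1, k + 2}"
        using k True by (auto simp: blocks_def)
      ultimately show ?thesis
        using mixed_partial_near[of "j + 1 - k" "i + 1 - k" "\<lambda>l. p (k + l)"]
        by (simp add: block_partials_def del: partials_simps)
    qed (auto simp: block_partials_def)
    then have "(\<Sum>j\<in>{..<m} - {i}. \<bar>block_partials f [i + 1, j + 1] k p\<bar>)
        \<le> (\<Sum>j\<in>{..<m} - {i}. if j = j' then 1 / 10 else 0)"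
      by (intro sum_mono) auto
    also have "\<dots> \<le> 1 / 10" by (simp add: sum.delta)
    finally show ?thesis .
  qed
  have "(\<Sum>j\<in>{..<m} - {i}. \<bar>hessian m (chain_sum f n) p $$ (i, j)\<bar>)
      \<le> (\<Sum>j\<in>{..<m} - {i}. \<Sum>k\<in>blocks n (i + 1). \<bar>block_partials f [i + 1, j + 1] k p\<bar>)"
    using assms by (intro sum_mono) (auto simp: hessian_entry simp del: add_2_eq_Suc' intro!: sum_abs)
  also have "\<dots> = (\<Sum>k\<in>blocks n (i + 1). \<Sum>j\<in>{..<m} - {i}. \<bar>block_partials f [i + 1, j + 1] k p\<bar>)"
    by (rule sum.swap)
  also have "\<dots> \<le> (\<Sum>k\<in>blocks n (i + 1). 1 / 10)"
    by (intro sum_mono block)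
  finally show ?thesis by simp
qed

lemma hessian_diagonal:
  assumes "i < m"
  shows "card (blocks n (i + 1)) * (\<bar>cos_deriv 0 (p (i + 1))\<bar> - 1 / 10)
    \<le> \<bar>hessian m (chain_sum f n) p $$ (i, i)\<bar>"
proof -
  let ?b = "\<lambda>k. block_partials f [i + 1, i + 1] k p" and ?u = "cos_deriv 0 (p (i + 1))"
  have "\<bar>?b k + ?u\<bar> \<le> 1 / 10" if k: "k \<in> blocks n (i + 1)" for k
  proof -
    have "i + 1 - k \<in> {1, 2}" "k + (i + 1 - k) = i + 1" "set [i + 1, i + 1] \<subseteq> {k + 1, k + 2}"
      using k by (auto simp: blocks_def)
    then show ?thesis
      using diagonal_partial_near[of "i + 1 - k" "\<lambda>l. p (k + l)"]
      by (simp add: block_partials_def del: partials_simps)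
  qed
  then have "\<bar>\<Sum>k\<in>blocks n (i + 1). ?b k + ?u\<bar> \<le> (\<Sum>k\<in>blocks n (i + 1). 1 / 10)"
    by (intro order_trans[OF sum_abs] sum_mono)
  then have "\<bar>hessian m (chain_sum f n) p $$ (i, i) + card (blocks n (i + 1)) * ?u\<bar>
      \<le> card (blocks n (i + 1)) / 10"
    using assms by (simp add: hessian_entry sum.distrib)
  moreover have "\<bar>card (blocks n (i + 1)) * ?u\<bar> = card (blocks n (i + 1)) * \<bar>?u\<bar>"
    by (simp add: abs_mult)
  ultimately show ?thesis unfolding right_diff_distrib by linarith
qed

text \<open>
  For every block containing the coordinate, the diagonal gains at least
  \<open>1/2 - 1/10\<close> because the cosine is at least \<open>1/2\<close> in absolute value where the sine is at
  most \<open>1/10\<close>; the off-diagonal entries cost at most \<open>1/10\<close>.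
\<close>

lemma nondegenerate_Cr:
  assumes n: "n \<ge> 1" and p: "p \<in> Cr (n + 1) (chain_sum f n)"
  shows "nondegenerate (n + 1) (chain_sum f n) p"
  unfolding nondegenerate_def
proof (rule det_nonzero_if_diagonally_dominant)
  show "hessian (n + 1) (chain_sum f n) p \<in> carrier_mat (n + 1) (n + 1)"
    by (simp add: hessian_def)
  fix i assume i: "i < n + 1"
  define c where "c = real (card (blocks n (i + 1)))"
  have c: "c > 0" using card_blocks_pos[OF n, of "i + 1"] i by (simp add: c_def)
  have "\<bar>cos_deriv 1 (p (i + 1))\<bar> \<le> 1 / 10"
    using critical_point_near[OF n p, of "i + 1"] i by simp
  moreover have "(cos_deriv 0 (p (i + 1)))\<^sup>2 + (cos_deriv 1 (p (i + 1)))\<^sup>2 = 1"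
    by (rule circle_cases[of "p (i + 1)"]) (simp add: cos_deriv_circle_of)
  moreover have "(cos_deriv 1 (p (i + 1)))\<^sup>2 \<le> (1 / 10)\<^sup>2"
    using calculation(1) by (metis abs_le_square_iff abs_of_pos zero_less_divide_1_iff zero_less_numeral)
  ultimately have "(1 / 2)\<^sup>2 < (cos_deriv 0 (p (i + 1)))\<^sup>2"
    by (simp add: power2_eq_square)
  then have "1 / 2 < \<bar>cos_deriv 0 (p (i + 1))\<bar>"
    using abs_le_square_iff[of "cos_deriv 0 (p (i + 1))" "1 / 2"] by (auto simp: not_le[symmetric])
  then have "c / 10 < c * (\<bar>cos_deriv 0 (p (i + 1))\<bar> - 1 / 10)"
    using c by (simp add: field_simps)
  with hessian_diagonal[OF i, of n p] hessian_off_diagonal[OF i, of n p]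
  show "(\<Sum>j\<in>{..<n + 1} - {i}. \<bar>hessian (n + 1) (chain_sum f n) p $$ (i, j)\<bar>)
      < \<bar>hessian (n + 1) (chain_sum f n) p $$ (i, i)\<bar>"
    unfolding c_def by linarith
qed

end

theorem theorem1p4:
  "\<exists>(d::nat) V. d > 0 \<and> V \<noteq> {} \<and> openin Cinf_topology V \<and>
     (\<forall>f\<in>V.
        (\<forall>n\<ge>1. Morse (n + 1) (chain_sum f n)) \<and>
        (\<forall>n\<ge>1. card (Cr (n + 1) (chain_sum f n)) = d ^ (n + 1)))"
proof (intro exI conjI ballI allI impI)
  let ?V = "Ck_ball 2 cos_cos (1 / 10)"
  show "(2::nat) > 0" by simp
  have "cos_cos \<in> ?V" by (simp add: Ck_ball_def cos_cos_in_Cinf)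
  then show "?V \<noteq> {}" by blast
  show "openin Cinf_topology ?V"
    unfolding Cinf_topology_def
    by (rule topology_generated_by_Basis, rule CollectI,
        rule exI[of _ 2], rule exI[of _ cos_cos], rule exI[of _ "1 / 10"])
      (simp add: cos_cos_in_Cinf)
  fix f and n :: nat
  assume f: "f \<in> ?V" and n: "1 \<le> n"
  show "Morse (n + 1) (chain_sum f n)"
    unfolding Morse_def using smooth_chain_sum[OF smooth_f[OF f]] nondegenerate_Cr[OF f n] by blast
  show "card (Cr (n + 1) (chain_sum f n)) = 2 ^ (n + 1)"
    using bij_betw_same_card[OF bij_betw_Cr[OF f n]] by (simp add: card_Pow)
qed

end
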